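(* Assume CH. Then there exists an ultrafilter $\mathcal{D}$ on $\bigcup_{i<\omega}\{i\}\times(i+1)$ which is semi-Ramsey but not almost Ramsey.
   Context: Let $I=\bigcup_{i<\omega}\{i\}\times(i+1)$. For a filter $\mathcal{D}$ on $I$, the game $G^{sR}(\mathcal{D})$: at move $n$, Player I plays $A_n\in\mathcal{D}$ and Player II answers with $i_n\in\omega$ and $a_n\in[A_n\cap(\{i_n\}\times(i_n+1))]^{\le n}$; Player I wins if $\bigcup_n a_n\notin\mathcal{D}$. $\mathcal{D}$ is semi-Ramsey if Player I has no winning strategy in $G^{sR}(\mathcal{D})$. $\mathcal{D}$ is almost Ramsey if it is semi-Ramsey and for every $n,L<\omega$ and every colouring $f:\bigcup_i[\{i\}\times(i+1)]^{\le n}\to L$ there is $A\in\mathcal{D}$ such that for every $i$ and every $k\le n$, $f\restriction[A\cap(\{i\}\times(i+1))]^k$ is constant. *)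

theory Defs
  imports "HOL-Library.Ramsey" "HOL-Library.FuncSet"
begin

unbundle cardinal_syntax

text \<open>The continuum hypothesis \<open>2\<^sup>\<aleph>\<^sup>0 = \<aleph>\<^sub>1\<close>.\<close>

definition CH :: bool where
  "CH \<longleftrightarrow> ctwo ^c natLeq =o cardSuc natLeq"

text \<open>A natural number \<open>i + 1\<close>, read as the von Neumann ordinal, is the set \<open>{..i}\<close>.\<close>

definition level :: "nat \<Rightarrow> (nat \<times> nat) set" where
  "level i = {i} \<times> {..i}"

definition levels :: "(nat \<times> nat) set" where
  "levels = (\<Union>i. level i)"

text \<open>A filter on \<open>X\<close> is a filter on the whole type that is below \<open>principal X\<close>;
  its elements as a family of subsets of \<open>X\<close> are the following ones.\<close>

definition filter_sets :: "'a set \<Rightarrow> 'a filter \<Rightarrow> 'a set set" where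
  "filter_sets X D = {A. A \<subseteq> X \<and> (\<forall>\<^sub>F x in D. x \<in> A)}"

definition ultrafilter_on :: "'a set \<Rightarrow> 'a filter \<Rightarrow> bool" where
  "ultrafilter_on X D \<longleftrightarrow> D \<le> principal X \<and> D \<noteq> bot \<and>
     (\<forall>A\<subseteq>X. A \<in> filter_sets X D \<or> X - A \<in> filter_sets X D)"

definition nsets_le :: "'a set \<Rightarrow> nat \<Rightarrow> 'a set set" where
  "nsets_le A n = (\<Union>k\<le>n. nsets A k)"

text \<open>A strategy for Player I maps the list of the moves \<open>(i\<^sub>0, a\<^sub>0), \<dots>, (i\<^sub>n\<^sub>-\<^sub>1, a\<^sub>n\<^sub>-\<^sub>1)\<close> made so far
  by Player II to the set \<open>A\<^sub>n\<close>. Since Player I always has a legal move, it is no restriction to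
  require legal values also on lists that do not arise in a play.\<close>

type_synonym strategy = "(nat \<times> (nat \<times> nat) set) list \<Rightarrow> (nat \<times> nat) set"

definition I_move :: "strategy \<Rightarrow> (nat \<Rightarrow> nat) \<Rightarrow> (nat \<Rightarrow> (nat \<times> nat) set) \<Rightarrow> nat \<Rightarrow> (nat \<times> nat) set" where
  "I_move \<sigma> i a n = \<sigma> (map (\<lambda>m. (i m, a m)) [0..<n])"

definition winning_strategy :: "(nat \<times> nat) filter \<Rightarrow> strategy \<Rightarrow> bool" where
  "winning_strategy D \<sigma> \<longleftrightarrow>
     (\<forall>h. \<sigma> h \<in> filter_sets levels D) \<and>
     (\<forall>i a. (\<forall>n. a n \<in> nsets_le (I_move \<sigma> i a n \<inter> level (i n)) n)
        \<longrightarrow> (\<Union>n. a n) \<notin> filter_sets levels D)"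

definition semi_Ramsey :: "(nat \<times> nat) filter \<Rightarrow> bool" where
  "semi_Ramsey D \<longleftrightarrow> (\<nexists>\<sigma>. winning_strategy D \<sigma>)"

definition almost_Ramsey :: "(nat \<times> nat) filter \<Rightarrow> bool" where
  "almost_Ramsey D \<longleftrightarrow> semi_Ramsey D \<and>
     (\<forall>(n::nat) (L::nat). \<forall>f \<in> (\<Union>i. nsets_le (level i) n) \<rightarrow> {..<L}.
        \<exists>A \<in> filter_sets levels D. \<forall>i. \<forall>k\<le>n. \<exists>c. \<forall>s \<in> nsets (A \<inter> level i) k. f s = c)"

end

theory Submission
  imports Defs "HOL-Library.Countable_Set_Type" "HOL-Library.Discrete_Functions"
begin

text \<open>Every level carries an equivalence relation, the number of whose classes and the size of whose
  classes both tend to infinity with the level. Call a set positive if it contains, on arbitrarily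
  high levels, \<open>m\<close> elements from each of \<open>m\<close> classes, for every \<open>m\<close>. The sets that are not
  positive form an ideal, and a decreasing sequence of positive sets has a positive
  pseudo-intersection with at most \<open>n\<close> points on the \<open>n\<close>th level that it meets, where these levels
  grow as fast as desired. Under CH one obtains a tower of length \<open>\<omega>\<^sub>1\<close> of positive sets that
  generates an ultrafilter, and the growth condition lets Player II defeat every strategy.
  Equivalence is a colouring of pairs without positive homogeneous sets.\<close>

section \<open>The continuum hypothesis\<close>

text \<open>The order is the cardinal \<open>|UNIV|\<close> of the type itself, minus the diagonal.
  Proper initial segments of an infinite cardinal are smaller than it, and CH makes everything below
  the continuum countable.\<close>

lemma CH_well_order:
  assumes CH
  obtains R :: "(nat \<Rightarrow> bool) rel"
  where "wf R" "\<And>x y. x = y \<or> (x, y) \<in> R \<or> (y, x) \<in> R" "\<And>x. countable {y. (y, x) \<in> R}"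
proof -
  define r where "r = |UNIV :: (nat \<Rightarrow> bool) set|"
  have "ctwo ^c natLeq = r"
    by (simp add: cexp_def ctwo_def Field_natLeq Field_card_of r_def Func_def)
  with assms have r: "r =o cardSuc natLeq"
    by (simp add: CH_def)
  have wo: "well_order_on UNIV r"
    unfolding r_def by (rule card_of_well_order_on)
  have "countable {y. (y, x) \<in> r - Id}" for x
  proof -
    have "|underS r x| <o r"
      unfolding r_def by (rule card_of_underS[OF card_of_Card_order]) (simp add: Field_card_of)
    then have "|underS r x| <o cardSuc natLeq"
      using r ordLess_ordIso_trans by blast
    then have "|underS r x| \<le>o natLeq"
      by (simp add: cardSuc_ordLeq_ordLess natLeq_Card_order card_of_Card_order)
    moreover have "underS r x = {y. (y, x) \<in> r - Id}"
      by (auto simp: underS_def)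
    ultimately show ?thesis
      by (simp add: countable_card_le_natLeq)
  qed
  moreover have "wf (r - Id)" "x = y \<or> (x, y) \<in> r - Id \<or> (y, x) \<in> r - Id" for x y
    using wo by (auto simp: well_order_on_def linear_order_on_def partial_order_on_def
        preorder_on_def total_on_def)
  ultimately show ?thesis
    using that by blast
qed

lemma uncountable_nat_bool: "uncountable (UNIV :: (nat \<Rightarrow> bool) set)"
proof
  assume "countable (UNIV :: (nat \<Rightarrow> bool) set)"
  then obtain e :: "nat \<Rightarrow> nat \<Rightarrow> bool" where "range e = UNIV"
    by (metis UNIV_not_empty range_from_nat_into)
  then obtain n where "e n = (\<lambda>k. \<not> e k k)"
    by (metis UNIV_I rangeE)
  then show False
    by (metis (full_types))
qed

text \<open>The downward closure of \<open>H\<close> is countable, so it misses some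
  \<open>z\<close>, and totality puts \<open>z\<close> above \<open>H\<close>. This uncountable
  cofinality later provides a tower set almost below countably many given ones.\<close>

lemma countable_strict_upper_bound:
  fixes R :: "(nat \<Rightarrow> bool) rel"
  assumes total: "\<And>x y. x = y \<or> (x, y) \<in> R \<or> (y, x) \<in> R"
    and pred: "\<And>x. countable {y. (y, x) \<in> R}" and "countable H"
  obtains z where "\<And>x. x \<in> H \<Longrightarrow> (x, z) \<in> R"
proof -
  have "countable (\<Union>x\<in>H. insert x {y. (y, x) \<in> R})"
    using pred \<open>countable H\<close> by auto
  then have "(\<Union>x\<in>H. insert x {y. (y, x) \<in> R}) \<noteq> UNIV"
    using uncountable_nat_bool by auto
  then obtain z where "z \<notin> (\<Union>x\<in>H. insert x {y. (y, x) \<in> R})"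
    by blast
  then show ?thesis
    using that total by fastforce
qed

section \<open>Positive sets\<close>

text \<open>The second coordinate codes a pair \<open>(c, d)\<close>, of which \<open>c\<close>
  names the class. Each level is thus an initial piece, in coding order, of a grid with infinitely
  many infinite rows.\<close>

definition cls :: "nat \<times> nat \<Rightarrow> nat" where
  "cls p = fst (prod_decode (snd p))"

definition big :: "nat \<Rightarrow> (nat \<times> nat) set \<Rightarrow> bool" where
  "big m S \<longleftrightarrow> (\<exists>K. finite K \<and> card K = m \<and>
     (\<forall>c\<in>K. \<exists>T\<subseteq>S. finite T \<and> card T = m \<and> cls ` T \<subseteq> {c}))"

lemma big_mono:
  assumes "big m S" "k \<le> m" "S \<subseteq> S'"
  shows "big k S'"
proof -
  from assms(1) obtain K where K: "finite K" "card K = m"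
    "\<And>c. c \<in> K \<Longrightarrow> \<exists>T\<subseteq>S. finite T \<and> card T = m \<and> cls ` T \<subseteq> {c}"
    unfolding big_def by blast
  obtain L where L: "L \<subseteq> K" "card L = k" "finite L"
    using obtain_subset_with_card_n[of k K] K assms(2) by metis
  have "\<exists>T\<subseteq>S'. finite T \<and> card T = k \<and> cls ` T \<subseteq> {c}" if c: "c \<in> L" for c
  proof -
    obtain T where T: "T \<subseteq> S" "finite T" "card T = m" "cls ` T \<subseteq> {c}"
      using K(3) L(1) c by blast
    obtain T' where "T' \<subseteq> T" "card T' = k" "finite T'"
      using obtain_subset_with_card_n[of k T] T assms(2) by metis
    with T assms(3) show ?thesis
      by (intro exI[of _ T']) blast
  qed
  with L show ?thesis
    unfolding big_def by blast
qed

text \<open>Pigeonhole twice: each of the \<open>2 * m\<close> classes has \<open>m\<close> of its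
  \<open>2 * m\<close> points on one side of \<open>X\<close>, and then \<open>m\<close> of the
  classes agree on the side.\<close>

lemma big_split:
  assumes "big (2 * m) S"
  shows "big m (S \<inter> X) \<or> big m (S - X)"
proof -
  from assms obtain K where K: "finite K" "card K = 2 * m"
    "\<And>c. c \<in> K \<Longrightarrow> \<exists>T\<subseteq>S. finite T \<and> card T = 2 * m \<and> cls ` T \<subseteq> {c}"
    unfolding big_def by blast
  define good where "good Y c \<longleftrightarrow> (\<exists>T\<subseteq>Y. finite T \<and> card T = m \<and> cls ` T \<subseteq> {c})" for Y c
  have good: "good (S \<inter> X) c \<or> good (S - X) c" if c: "c \<in> K" for c
  proof -
    obtain T where T: "T \<subseteq> S" "finite T" "card T = 2 * m" "cls ` T \<subseteq> {c}"
      using K(3)[OF c] by blast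
    have "card (T \<inter> X) + card (T - X) = 2 * m"
      using card_Int_Diff[OF T(2), of X] T(3) by simp
    then consider "m \<le> card (T \<inter> X)" | "m \<le> card (T - X)"
      by linarith
    then show ?thesis
    proof cases
      case 1
      then obtain U where "U \<subseteq> T \<inter> X" "card U = m" "finite U"
        by (metis obtain_subset_with_card_n)
      with T have "good (S \<inter> X) c"
        unfolding good_def by (intro exI[of _ U]) blast
      then show ?thesis ..
    next
      case 2
      then obtain U where "U \<subseteq> T - X" "card U = m" "finite U"
        by (metis obtain_subset_with_card_n)
      with T have "good (S - X) c"
        unfolding good_def by (intro exI[of _ U]) blast
      then show ?thesis ..
    qed
  qed
  have conclude: "big m Y" if L: "L \<subseteq> K" "m \<le> card L" "\<And>c. c \<in> L \<Longrightarrow> good Y c" for L Y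
  proof -
    obtain L' where "L' \<subseteq> L" "card L' = m" "finite L'"
      using L(2) by (metis obtain_subset_with_card_n)
    with L show ?thesis
      unfolding big_def good_def by (intro exI[of _ L']) blast
  qed
  define K1 where "K1 = {c \<in> K. good (S \<inter> X) c}"
  have "K \<inter> K1 = K1"
    by (auto simp: K1_def)
  then have "card K1 + card (K - K1) = 2 * m"
    using card_Int_Diff[OF K(1), of K1] K(2) by simp
  then consider "m \<le> card K1" | "m \<le> card (K - K1)"
    by linarith
  then show ?thesis
  proof cases
    case 1
    then show ?thesis
      using conclude[of K1 "S \<inter> X"] K1_def by blast
  next
    case 2
    then show ?thesis
      using conclude[of "K - K1" "S - X"] K1_def good by blast
  qed
qed

text \<open>Only the \<open>m\<close> chosen points in each of the \<open>m\<close> chosen classes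
  matter. The bound is what allows growing bigness under a quota of \<open>n\<close> points on the
  \<open>n\<close>th level used.\<close>

lemma big_small_subset:
  assumes "big m S"
  obtains S' where "S' \<subseteq> S" "finite S'" "card S' \<le> m\<^sup>2" "big m S'"
proof -
  from assms obtain K T where K: "finite K" "card K = m"
    and T: "\<And>c. c \<in> K \<Longrightarrow> T c \<subseteq> S \<and> finite (T c) \<and> card (T c) = m \<and> cls ` T c \<subseteq> {c}"
    unfolding big_def by metis
  show ?thesis
  proof
    show "(\<Union>c\<in>K. T c) \<subseteq> S" "finite (\<Union>c\<in>K. T c)"
      using T K by auto
    have "card (\<Union>c\<in>K. T c) \<le> (\<Sum>c\<in>K. card (T c))"
      using K(1) by (rule card_UN_le)
    also have "\<dots> = m\<^sup>2"
      using T K by (simp add: power2_eq_square)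
    finally show "card (\<Union>c\<in>K. T c) \<le> m\<^sup>2" .
    show "big m (\<Union>c\<in>K. T c)"
      unfolding big_def using K T by (intro exI[of _ K]) blast
  qed
qed

text \<open>The \<open>m\<close> by \<open>m\<close> corner of the grid has finitely many codes, so
  all high enough levels contain it.\<close>

lemma big_level: "\<exists>j. \<forall>i\<ge>j. big m (level i)"
proof -
  define E where "E = {..<m} \<times> {..<m}"
  have "finite (prod_encode ` E)"
    by (simp add: E_def)
  then obtain j where j: "\<And>x. x \<in> E \<Longrightarrow> prod_encode x \<le> j"
    unfolding finite_nat_set_iff_bounded_le by blast
  have "big m (level i)" if "i \<ge> j" for i
    unfolding big_def
  proof (intro exI[of _ "{..<m}"] conjI ballI)
    fix c assume c: "c \<in> {..<m}"
    define T where "T = (\<lambda>d. (i, prod_encode (c, d))) ` {..<m}"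
    have "inj_on (\<lambda>d. (i, prod_encode (c, d))) {..<m}"
      by (auto simp: inj_on_def)
    then have "card T = m"
      by (simp add: T_def card_image)
    moreover have "prod_encode (c, d) \<le> i" if "d < m" for d
      using j[of "(c, d)"] c that \<open>i \<ge> j\<close> by (simp add: E_def)
    then have "T \<subseteq> level i"
      by (auto simp: T_def level_def)
    moreover have "finite T" "cls ` T \<subseteq> {c}"
      by (auto simp: T_def cls_def)
    ultimately show "\<exists>T\<subseteq>level i. finite T \<and> card T = m \<and> cls ` T \<subseteq> {c}"
      by blast
  qed auto
  then show ?thesis
    by blast
qed

definition pos :: "(nat \<times> nat) set \<Rightarrow> bool" where
  "pos A \<longleftrightarrow> (\<forall>m k. \<exists>i\<ge>k. big m (A \<inter> level i))"

lemma pos_levels: "pos levels"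
  unfolding pos_def
proof (intro allI)
  fix m k
  obtain j where "\<forall>i\<ge>j. big m (level i)"
    using big_level by blast
  then have "big m (levels \<inter> level (max j k))"
    by (metis Int_absorb1 UN_upper UNIV_I levels_def max.cobounded1)
  then show "\<exists>i\<ge>k. big m (levels \<inter> level i)"
    by (metis max.cobounded2)
qed

lemma pos_mono: "pos A \<Longrightarrow> A \<subseteq> B \<Longrightarrow> pos B"
  unfolding pos_def by (meson Int_mono big_mono order_refl)

text \<open>This is closure of the non-positive sets under unions: if both parts failed, with
  \<open>m\<close> and \<open>m'\<close>, then \<open>big_split\<close> at
  \<open>2 * max m m'\<close> would give a contradiction on a common high level.\<close>

lemma pos_split:
  assumes "pos A"
  shows "pos (A \<inter> X) \<or> pos (A - X)"
proof (rule ccontr)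
  assume "\<not> ?thesis"
  then obtain m k m' k' where *: "\<And>i. i \<ge> k \<Longrightarrow> \<not> big m (A \<inter> X \<inter> level i)"
    "\<And>i. i \<ge> k' \<Longrightarrow> \<not> big m' ((A - X) \<inter> level i)"
    unfolding pos_def by blast
  obtain i where i: "i \<ge> max k k'" "big (2 * max m m') (A \<inter> level i)"
    using assms unfolding pos_def by blast
  have "A \<inter> level i \<inter> X = A \<inter> X \<inter> level i" "A \<inter> level i - X = (A - X) \<inter> level i"
    by auto
  with big_split[OF i(2), of X] * i(1) show False
    by (metis big_mono max.bounded_iff max.cobounded1 max.cobounded2 order_refl)
qed

text \<open>Since levels are finite, for subsets of \<open>levels\<close> this is inclusion modulo a
  finite set.\<close>

definition almost_subset :: "(nat \<times> nat) set \<Rightarrow> (nat \<times> nat) set \<Rightarrow> bool" (infix \<open>\<subseteq>*\<close> 50) where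
  "A \<subseteq>* B \<longleftrightarrow> (\<exists>k. \<forall>p\<in>A. k \<le> fst p \<longrightarrow> p \<in> B)"

lemma subset_almost_subset: "A \<subseteq> B \<Longrightarrow> A \<subseteq>* B"
  unfolding almost_subset_def by blast

lemma almost_subset_trans:
  assumes "A \<subseteq>* B" "B \<subseteq>* C"
  shows "A \<subseteq>* C"
proof -
  obtain k l where "\<forall>p\<in>A. k \<le> fst p \<longrightarrow> p \<in> B" "\<forall>p\<in>B. l \<le> fst p \<longrightarrow> p \<in> C"
    using assms unfolding almost_subset_def by blast
  then have "\<forall>p\<in>A. max k l \<le> fst p \<longrightarrow> p \<in> C"
    by simp
  then show ?thesis
    unfolding almost_subset_def by blast
qed

lemma almost_subset_Int:
  assumes "A \<subseteq>* B" "A \<subseteq>* C"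
  shows "A \<subseteq>* B \<inter> C"
proof -
  obtain k l where "\<forall>p\<in>A. k \<le> fst p \<longrightarrow> p \<in> B" "\<forall>p\<in>A. l \<le> fst p \<longrightarrow> p \<in> C"
    using assms unfolding almost_subset_def by blast
  then have "\<forall>p\<in>A. max k l \<le> fst p \<longrightarrow> p \<in> B \<inter> C"
    by simp
  then show ?thesis
    unfolding almost_subset_def by blast
qed

lemma fst_level: "p \<in> level i \<Longrightarrow> fst p = i"
  by (auto simp: level_def)

lemma pos_almost_subset:
  assumes "pos A" "A \<subseteq>* B"
  shows "pos B"
  unfolding pos_def
proof (intro allI)
  fix m k
  obtain l where l: "\<forall>p\<in>A. l \<le> fst p \<longrightarrow> p \<in> B"
    using assms(2) unfolding almost_subset_def by blast
  obtain i where i: "i \<ge> max k l" "big m (A \<inter> level i)"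
    using assms(1) unfolding pos_def by blast
  have "A \<inter> level i \<subseteq> B \<inter> level i"
    using l i(1) fst_level by auto
  with i show "\<exists>i\<ge>k. big m (B \<inter> level i)"
    by (metis big_mono max.bounded_iff order_refl)
qed

section \<open>One step of the tower\<close>

text \<open>The index \<open>n\<close> of the level \<open>i n\<close> is the move at which Player
  II will use it: \<open>n\<close> is the quota of points for that move, and \<open>h\<close>
  prescribes the gaps that give Player II time.\<close>

definition slow :: "(nat \<Rightarrow> nat) \<Rightarrow> (nat \<times> nat) set \<Rightarrow> bool" where
  "slow h C \<longleftrightarrow> (\<exists>i. strict_mono i \<and> (\<forall>n. h (i n) \<le> i (Suc n)) \<and>
     C \<subseteq> (\<Union>n. level (i n)) \<and> (\<forall>n. card (C \<inter> level (i n)) \<le> n))"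

text \<open>A diagonal choice: the \<open>n\<close>th slice is taken from \<open>B n\<close>, on a
  level far enough beyond the previous one, as big as its quota of \<open>n\<close> points
  permits.\<close>

lemma slow_pseudo_intersection:
  fixes B :: "nat \<Rightarrow> (nat \<times> nat) set"
  assumes "\<And>n. pos (B n)" "decseq B"
  obtains C where "pos C" "C \<subseteq> B 0" "\<And>n. C \<subseteq>* B n" "slow h C"
proof -
  define P where "P n q \<longleftrightarrow> snd q \<subseteq> B n \<inter> level (fst q) \<and> card (snd q) \<le> n \<and>
      big (floor_sqrt n) (snd q)" for n and q :: "nat \<times> (nat \<times> nat) set"
  \<comment> \<open>\<open>floor_sqrt n\<close> is the largest bigness whose square stays within the
    quota \<open>n\<close>, and it tends to infinity with \<open>n\<close>.\<close>
  have ex: "\<exists>q. P n q \<and> k \<le> fst q" for n k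
  proof -
    obtain i where i: "i \<ge> k" "big (floor_sqrt n) (B n \<inter> level i)"
      using assms(1) unfolding pos_def by blast
    obtain S where S: "S \<subseteq> B n \<inter> level i" "card S \<le> (floor_sqrt n)\<^sup>2" "big (floor_sqrt n) S"
      using big_small_subset[OF i(2)] by metis
    have "card S \<le> n"
      using S(2) floor_sqrt_power2_le order_trans by blast
    with S i(1) show ?thesis
      unfolding P_def by (intro exI[of _ "(i, S)"]) simp
  qed
  have "\<exists>f. \<forall>n. P n (f n) \<and> (fst (f n) < fst (f (Suc n)) \<and> h (fst (f n)) \<le> fst (f (Suc n)))"
  proof (rule dependent_nat_choice[where Q = "\<lambda>_ q q'. fst q < fst q' \<and> h (fst q) \<le> fst q'"])
    show "\<exists>q. P 0 q"
      using ex by blast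
    show "\<exists>q'. P (Suc n) q' \<and> (fst q < fst q' \<and> h (fst q) \<le> fst q')" for q n
      using ex[of "Suc n" "max (Suc (fst q)) (h (fst q))"] by auto
  qed
  then obtain f where P: "\<And>n. P n (f n)"
    and f: "\<And>n. fst (f n) < fst (f (Suc n))" "\<And>n. h (fst (f n)) \<le> fst (f (Suc n))"
    by blast
  define i where "i n = fst (f n)" for n
  define a where "a n = snd (f n)" for n
  have a: "a n \<subseteq> B n" "a n \<subseteq> level (i n)" "card (a n) \<le> n" "big (floor_sqrt n) (a n)" for n
    using P[of n] by (auto simp: P_def a_def i_def)
  have mono: "strict_mono i"
    using f(1) by (simp add: strict_mono_Suc_iff i_def)
  have slice: "(\<Union>n. a n) \<inter> level (i n) = a n" for n
  proof -
    have "p \<in> a n" if "p \<in> a j" "p \<in> level (i n)" for p j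
      using that a(2)[of j] fst_level strict_mono_eq[OF mono] by (metis subsetD)
    then show ?thesis
      using a(2)[of n] by blast
  qed
  show ?thesis
  proof
    show "pos (\<Union>n. a n)"
      unfolding pos_def
    proof (intro allI)
      fix m k :: nat
      \<comment> \<open>The square secures \<open>m \<le> floor_sqrt n\<close>; the other bound
        secures \<open>k \<le> i n\<close>, as \<open>n \<le> i n\<close>.\<close>
      define n where "n = max (m\<^sup>2) k"
      have "m \<le> floor_sqrt n"
        by (simp add: n_def le_floor_sqrt_iff)
      then have "big m ((\<Union>n. a n) \<inter> level (i n))"
        using a(4)[of n] big_mono slice by blast
      moreover have "k \<le> i n"
        using strict_mono_imp_increasing[OF mono, of n] by (simp add: n_def)
      ultimately show "\<exists>i\<ge>k. big m ((\<Union>n. a n) \<inter> level i)"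
        by blast
    qed
    show "(\<Union>n. a n) \<subseteq> B 0"
      using a(1) decseqD[OF assms(2)] by blast
    show "(\<Union>n. a n) \<subseteq>* B n" for n
      unfolding almost_subset_def
    proof (intro exI[of _ "i n"] ballI impI)
      fix p assume "p \<in> (\<Union>n. a n)" "i n \<le> fst p"
      then obtain j where j: "p \<in> a j" "i n \<le> fst p"
        by blast
      \<comment> \<open>Only slices \<open>a j\<close> with \<open>j \<ge> n\<close> reach level
        \<open>i n\<close> or higher, and \<open>B j \<subseteq> B n\<close> for these.\<close>
      then have "n \<le> j"
        using a(2)[of j] fst_level[of p "i j"] strict_mono_less_eq[OF mono] by auto
      then show "p \<in> B n"
        using j a(1)[of j] decseqD[OF assms(2)] by blast
    qed
    have "(\<Union>n. a n) \<subseteq> (\<Union>n. level (i n))"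
      using a(2) by blast
    moreover have "\<forall>n. h (i n) \<le> i (Suc n)"
      using f(2) by (simp add: i_def)
    ultimately show "slow h (\<Union>n. a n)"
      unfolding slow_def using mono slice a(3) by (metis (no_types, lifting))
  qed
qed

text \<open>One side of \<open>X\<close> serves all \<open>n\<close> at once: if the two sides
  failed at \<open>n\<close> and \<open>n'\<close>, both would fail at the maximum, against
  \<open>pos_split\<close>. The pseudo-intersection is then taken on that side.\<close>

lemma tower_step_decseq:
  fixes B :: "nat \<Rightarrow> (nat \<times> nat) set"
  assumes "\<And>n. pos (B n)" "decseq B"
  obtains C where "pos C" "C \<subseteq> B 0" "\<And>n. C \<subseteq>* B n" "slow h C" "C \<subseteq> X \<or> C \<inter> X = {}"
proof -
  have "(\<forall>n. pos (B n \<inter> X)) \<or> (\<forall>n. pos (B n - X))"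
  proof (rule ccontr)
    assume "\<not> ?thesis"
    then obtain n n' where n: "\<not> pos (B n \<inter> X)" "\<not> pos (B n' - X)"
      by blast
    let ?m = "max n n'"
    have "B ?m \<subseteq> B n" "B ?m \<subseteq> B n'"
      using decseqD[OF assms(2)] by simp_all
    then have "B ?m \<inter> X \<subseteq> B n \<inter> X" "B ?m - X \<subseteq> B n' - X"
      by auto
    then show False
      using n pos_split[OF assms(1), of ?m X] pos_mono by blast
  qed
  then show ?thesis
  proof
    assume "\<forall>n. pos (B n \<inter> X)"
    moreover have "decseq (\<lambda>n. B n \<inter> X)"
      using assms(2) by (fastforce simp: decseq_def)
    ultimately obtain C where C: "pos C" "C \<subseteq> B 0 \<inter> X" "\<And>n. C \<subseteq>* B n \<inter> X" "slow h C"
      using slow_pseudo_intersection[of "\<lambda>n. B n \<inter> X" h] by blast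
    then show ?thesis
      using that[of C] almost_subset_trans[OF C(3) subset_almost_subset] by blast
  next
    assume "\<forall>n. pos (B n - X)"
    moreover have "decseq (\<lambda>n. B n - X)"
      using assms(2) by (fastforce simp: decseq_def)
    ultimately obtain C where C: "pos C" "C \<subseteq> B 0 - X" "\<And>n. C \<subseteq>* B n - X" "slow h C"
      using slow_pseudo_intersection[of "\<lambda>n. B n - X" h] by blast
    then show ?thesis
      using that[of C] almost_subset_trans[OF C(3) subset_almost_subset] by blast
  qed
qed

lemma tower_step:
  assumes "countable F" "\<And>A. A \<in> F \<Longrightarrow> pos A" "\<And>A. A \<in> F \<Longrightarrow> A \<subseteq> levels"
    and chain: "\<And>A B. A \<in> F \<Longrightarrow> B \<in> F \<Longrightarrow> A \<subseteq>* B \<or> B \<subseteq>* A"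
  obtains C where "pos C" "C \<subseteq> levels" "\<And>A. A \<in> F \<Longrightarrow> C \<subseteq>* A" "slow h C" "C \<subseteq> X \<or> C \<inter> X = {}"
proof -
  \<comment> \<open>Adding \<open>levels\<close> makes the family nonempty, so that it can be
    enumerated even at the first stage of the tower.\<close>
  let ?F = "insert levels F"
  define e where "e = from_nat_into ?F"
  have range: "range e = ?F"
    unfolding e_def using assms(1) by (simp add: range_from_nat_into)
  have e: "e n \<in> ?F" for n
    using range by blast
  have chain': "A \<subseteq>* B \<or> B \<subseteq>* A" if "A \<in> ?F" "B \<in> ?F" for A B
    using that chain assms(3) subset_almost_subset by (metis insert_iff order_refl)
  define B where "B n = (\<Inter>m\<le>n. e m)" for n
  \<comment> \<open>Among finitely many members of the chain one is almost below all the others,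
    hence almost below their intersection; this makes \<open>B n\<close> positive.\<close>
  have "\<exists>A\<in>?F. A \<subseteq>* B n" for n
  proof (induction n)
    case 0
    have "e 0 \<subseteq>* B 0"
      by (simp add: B_def subset_almost_subset)
    then show ?case
      using e by blast
  next
    case (Suc n)
    then obtain A where A: "A \<in> ?F" "A \<subseteq>* B n"
      by blast
    have eq: "B (Suc n) = B n \<inter> e (Suc n)"
      by (auto simp: B_def atMost_Suc)
    from chain'[OF A(1) e] show ?case
    proof
      assume "A \<subseteq>* e (Suc n)"
      then show ?thesis
        using A almost_subset_Int eq by metis
    next
      assume "e (Suc n) \<subseteq>* A"
      then have "e (Suc n) \<subseteq>* B (Suc n)"
        using A almost_subset_Int almost_subset_trans subset_almost_subset eq by (metis order_refl)
      then show ?thesis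
        using e by blast
    qed
  qed
  then have "pos (B n)" for n
    using pos_almost_subset pos_levels assms(2) by (metis insert_iff)
  moreover have "decseq B"
    by (auto simp: decseq_def B_def)
  ultimately obtain C where C: "pos C" "C \<subseteq> B 0" "\<And>n. C \<subseteq>* B n" "slow h C" "C \<subseteq> X \<or> C \<inter> X = {}"
    using tower_step_decseq[of B h X] by blast
  have "C \<subseteq> levels"
    using C(2) e[of 0] assms(3) by (fastforce simp: B_def)
  moreover have "C \<subseteq>* A" if A: "A \<in> F" for A
  proof -
    obtain n where "A = e n"
      using range A by (metis insertI2 rangeE)
    then have "B n \<subseteq> A"
      by (auto simp: B_def)
    then show ?thesis
      using C(3) almost_subset_trans subset_almost_subset by blast
  qed
  ultimately show ?thesis
    using that C by blast
qed

section \<open>The tower\<close>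

text \<open>An index of the tower also codes its tasks: stage \<open>b\<close> decides the set
  \<open>coded_set b\<close> and obeys the growth function \<open>coded_fun b\<close>. Surjectivity
  of both codings ensures that every task is met.\<close>

definition coded_set :: "(nat \<Rightarrow> bool) \<Rightarrow> (nat \<times> nat) set" where
  "coded_set b = {p. b (prod_encode p)}"

text \<open>If \<open>b\<close> codes the graph of a function, the choice is forced; any other
  \<open>b\<close> yields some function, which does no harm.\<close>

definition coded_fun :: "(nat \<Rightarrow> bool) \<Rightarrow> nat \<Rightarrow> nat" where
  "coded_fun b n = (SOME m. b (prod_encode (n, m)))"

lemma coded_set_surj: "\<exists>b. coded_set b = A"
  by (rule exI[of _ "\<lambda>k. prod_decode k \<in> A"]) (simp add: coded_set_def)

lemma coded_fun_surj: "\<exists>b. coded_fun b = h"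
  by (rule exI[of _ "\<lambda>k. snd (prod_decode k) = h (fst (prod_decode k))"])
    (simp add: coded_fun_def fun_eq_iff)

text \<open>Well-founded recursion along \<open>R\<close>: the sets built before stage
  \<open>x\<close> form a countable chain under almost inclusion, so \<open>tower_step\<close>
  applies to them.\<close>

lemma tower_exists:
  assumes "wf R" and total: "\<And>x y. x = y \<or> (x, y) \<in> R \<or> (y, x) \<in> R"
    and count: "\<And>x. countable {y. (y, x) \<in> R}"
  obtains T :: "(nat \<Rightarrow> bool) \<Rightarrow> (nat \<times> nat) set"
  where "\<And>x. pos (T x)" "\<And>x. T x \<subseteq> levels" "\<And>x y. (y, x) \<in> R \<Longrightarrow> T x \<subseteq>* T y"
    "\<And>x. slow (coded_fun x) (T x)" "\<And>x. T x \<subseteq> coded_set x \<or> T x \<inter> coded_set x = {}"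
proof -
  define P where "P f x C \<longleftrightarrow> pos C \<and> C \<subseteq> levels \<and> (\<forall>y. (y, x) \<in> R \<longrightarrow> C \<subseteq>* f y) \<and>
      slow (coded_fun x) C \<and> (C \<subseteq> coded_set x \<or> C \<inter> coded_set x = {})"
    for f :: "(nat \<Rightarrow> bool) \<Rightarrow> (nat \<times> nat) set" and x C
  have "\<exists>T. \<forall>x. P T x (T x)"
  proof (rule dependent_wf_choice[OF \<open>wf R\<close>])
    show "P f x C = P g x C" if "\<And>z. (z, x) \<in> R \<Longrightarrow> f z = g z" for f g x C
      using that by (simp add: P_def)
    show "\<exists>C. P f x C" if f: "\<And>y. (y, x) \<in> R \<Longrightarrow> P f y (f y)" for x f
    proof -
      have chain: "A \<subseteq>* B \<or> B \<subseteq>* A"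
        if AB: "A \<in> f ` {y. (y, x) \<in> R}" "B \<in> f ` {y. (y, x) \<in> R}" for A B
      proof -
        obtain y z where "A = f y" "(y, x) \<in> R" "B = f z" "(z, x) \<in> R"
          using AB by blast
        then show ?thesis
          using total[of y z] f[of y] f[of z] subset_almost_subset unfolding P_def by blast
      qed
      have "countable (f ` {y. (y, x) \<in> R})" "\<And>A. A \<in> f ` {y. (y, x) \<in> R} \<Longrightarrow> pos A"
        "\<And>A. A \<in> f ` {y. (y, x) \<in> R} \<Longrightarrow> A \<subseteq> levels"
        using count f unfolding P_def by blast+
      from tower_step[OF this chain, of "coded_fun x" "coded_set x"] show ?thesis
        unfolding P_def by (metis (no_types, lifting) imageI mem_Collect_eq)
    qed
  qed
  then show ?thesis
    using that unfolding P_def by blast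
qed

section \<open>The ultrafilter\<close>

definition tower_filter :: "('b \<Rightarrow> (nat \<times> nat) set) \<Rightarrow> (nat \<times> nat) filter" where
  "tower_filter T = Abs_filter (\<lambda>P. \<exists>x. T x \<subseteq>* Collect P)"

lemma eventually_tower_filter:
  assumes "\<And>x y. T x \<subseteq>* T y \<or> T y \<subseteq>* T x"
  shows "eventually P (tower_filter T) \<longleftrightarrow> (\<exists>x. T x \<subseteq>* Collect P)"
  unfolding tower_filter_def
proof (rule eventually_Abs_filter, rule is_filter.intro)
  show "\<exists>x. T x \<subseteq>* {x. True}"
    by (simp add: subset_almost_subset)
next
  fix P Q assume "\<exists>x. T x \<subseteq>* Collect P" "\<exists>x. T x \<subseteq>* Collect Q"
  then obtain x y where "T x \<subseteq>* Collect P" "T y \<subseteq>* Collect Q"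
    by blast
  \<comment> \<open>Whichever of \<open>T x\<close> and \<open>T y\<close> is almost below the other
    serves both predicates.\<close>
  then have "\<exists>z. T z \<subseteq>* Collect P \<and> T z \<subseteq>* Collect Q"
    using assms almost_subset_trans by metis
  then show "\<exists>x. T x \<subseteq>* {x. P x \<and> Q x}"
    using almost_subset_Int by (metis Collect_conj_eq)
next
  fix P Q :: "nat \<times> nat \<Rightarrow> bool"
  assume "\<forall>x. P x \<longrightarrow> Q x" "\<exists>x. T x \<subseteq>* Collect P"
  then show "\<exists>x. T x \<subseteq>* Collect Q"
    using almost_subset_trans subset_almost_subset by (metis Collect_mono)
qed

lemma filter_sets_tower_filter:
  assumes "\<And>x y. T x \<subseteq>* T y \<or> T y \<subseteq>* T x"
  shows "A \<in> filter_sets X (tower_filter T) \<longleftrightarrow> A \<subseteq> X \<and> (\<exists>x. T x \<subseteq>* A)"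
  unfolding filter_sets_def by (simp add: eventually_tower_filter[OF assms])

lemma not_pos_empty: "\<not> pos {}"
proof -
  have "\<not> big 1 {}"
    by (auto simp: big_def card_1_singleton_iff)
  then show ?thesis
    by (auto simp: pos_def)
qed

lemma ultrafilter_tower_filter:
  assumes chain: "\<And>x y. T x \<subseteq>* T y \<or> T y \<subseteq>* T x" and "\<And>x. pos (T x)" "\<And>x. T x \<subseteq> levels"
    and decides: "\<And>A. \<exists>x. T x \<subseteq> A \<or> T x \<inter> A = {}"
  shows "ultrafilter_on levels (tower_filter T)"
  unfolding ultrafilter_on_def
proof (intro conjI allI impI)
  show "tower_filter T \<le> principal levels"
    using assms(3) subset_almost_subset
    by (auto simp: le_principal eventually_tower_filter[OF chain])
  show "tower_filter T \<noteq> bot"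
    using assms(2) pos_almost_subset not_pos_empty
    by (auto simp: trivial_limit_def eventually_tower_filter[OF chain])
  fix A :: "(nat \<times> nat) set" assume "A \<subseteq> levels"
  obtain x where "T x \<subseteq> A \<or> T x \<inter> A = {}"
    using decides by blast
  then have "T x \<subseteq> A \<or> T x \<subseteq> levels - A"
    using assms(3)[of x] by blast
  then show "A \<in> filter_sets levels (tower_filter T) \<or> levels - A \<in> filter_sets levels (tower_filter T)"
    using \<open>A \<subseteq> levels\<close> subset_almost_subset
    unfolding filter_sets_tower_filter[OF chain] by blast
qed

text \<open>On some level a positive set has two equivalent points as well as two inequivalent ones,
  so the colouring by equivalence takes both values on its pairs.\<close>

lemma not_almost_Ramsey:
  assumes "\<And>A. A \<in> filter_sets levels D \<Longrightarrow> pos A"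
  shows "\<not> almost_Ramsey D"
proof
  assume D: "almost_Ramsey D"
  define f where "f s = (if card (cls ` s) = 1 then 1 else 0 :: nat)" for s
  have "f \<in> (\<Union>i. nsets_le (level i) 2) \<rightarrow> {..<2}"
    by (auto simp: f_def)
  then have "\<exists>A \<in> filter_sets levels D. \<forall>i. \<forall>k\<le>2. \<exists>c. \<forall>s \<in> nsets (A \<inter> level i) k. f s = c"
    using D unfolding almost_Ramsey_def by blast
  then obtain A where A: "A \<in> filter_sets levels D"
    "\<And>i k. k \<le> 2 \<Longrightarrow> \<exists>c. \<forall>s\<in>nsets (A \<inter> level i) k. f s = c"
    by blast
  obtain i where "big 2 (A \<inter> level i)"
    using assms[OF A(1)] unfolding pos_def by blast
  then obtain K where K: "card K = 2"
    and T: "\<And>c. c \<in> K \<Longrightarrow> \<exists>T\<subseteq>A \<inter> level i. finite T \<and> card T = 2 \<and> cls ` T \<subseteq> {c}"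
    unfolding big_def by blast
  obtain c d where cd: "c \<in> K" "d \<in> K" "c \<noteq> d"
    using K by (auto simp: card_2_iff)
  obtain S where S: "S \<subseteq> A \<inter> level i" "finite S" "card S = 2" "cls ` S \<subseteq> {c}"
    using T[OF cd(1)] by blast
  obtain S' where S': "S' \<subseteq> A \<inter> level i" "finite S'" "card S' = 2" "cls ` S' \<subseteq> {d}"
    using T[OF cd(2)] by blast
  have "S \<noteq> {}" "S' \<noteq> {}"
    using S(3) S'(3) by auto
  then obtain p q where p: "p \<in> S" "cls p = c" and q: "q \<in> S'" "cls q = d"
    using S(4) S'(4) by blast
  have "S \<in> nsets (A \<inter> level i) 2"
    using S by (simp add: nsets_def)
  moreover have "p \<noteq> q"
    using p q cd(3) by blast
  then have "{p, q} \<in> nsets (A \<inter> level i) 2"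
    using p q S(1) S'(1) by (auto simp: nsets_def)
  ultimately have "f S = f {p, q}"
    using A(2)[of 2 i] by force
  moreover have "cls ` S = {c}"
    using S(4) p by blast
  moreover have "cls ` {p, q} = {c, d}"
    using p q by auto
  ultimately show False
    using cd(3) by (simp add: f_def)
qed

section \<open>The game\<close>

text \<open>A finite set that contains every position reached by playing strictly increasing levels
  up to \<open>N\<close>: such a play makes at most \<open>Suc N\<close> moves.\<close>

definition positions :: "nat \<Rightarrow> (nat \<times> (nat \<times> nat) set) list set" where
  "positions N = {h. set h \<subseteq> {..N} \<times> Pow (\<Union>i\<le>N. level i) \<and> length h \<le> Suc N}"

lemma finite_positions: "finite (positions N)"
  unfolding positions_def by (rule finite_lists_length_le) (simp add: level_def)

text \<open>Player II follows the slow set: when the level \<open>i (Suc n)\<close> is played, it lies beyond the finitely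
  many points where \<open>B\<close> leaves Player I's answers to positions bounded by \<open>i n\<close>.\<close>

lemma semi_RamseyI:
  assumes pseudo: "\<And>A. (\<And>n :: nat. A n \<in> filter_sets levels D) \<Longrightarrow>
      \<exists>C \<in> filter_sets levels D. \<forall>n. C \<subseteq>* A n"
    and slow: "\<And>h. \<exists>C \<in> filter_sets levels D. slow h C"
  shows "semi_Ramsey D"
  unfolding semi_Ramsey_def
proof
  assume "\<exists>\<sigma>. winning_strategy D \<sigma>"
  then obtain \<sigma> where \<sigma>: "\<And>h. \<sigma> h \<in> filter_sets levels D"
    and win: "\<And>i a. (\<And>n. a n \<in> nsets_le (I_move \<sigma> i a n \<inter> level (i n)) n) \<Longrightarrow>
        (\<Union>n. a n) \<notin> filter_sets levels D"
    unfolding winning_strategy_def by blast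
  let ?H = "\<Union>N. positions N"
  have "countable ?H"
    by (simp add: countable_finite finite_positions)
  moreover have "[] \<in> ?H"
    by (auto simp: positions_def)
  ultimately have range: "range (from_nat_into ?H) = ?H"
    by (intro range_from_nat_into) auto
  \<comment> \<open>There are only countably many positions, so a single \<open>B\<close> is almost
    below all answers of the strategy.\<close>
  obtain B where B: "B \<in> filter_sets levels D" "\<And>n. B \<subseteq>* \<sigma> (from_nat_into ?H n)"
    using pseudo[of "\<lambda>n. \<sigma> (from_nat_into ?H n)"] \<sigma> by blast
  have "B \<subseteq>* \<sigma> h" if "h \<in> ?H" for h
    using B(2) that range by (metis rangeE)
  then obtain k where k: "\<And>h p. h \<in> ?H \<Longrightarrow> p \<in> B \<Longrightarrow> k h \<le> fst p \<Longrightarrow> p \<in> \<sigma> h"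
    unfolding almost_subset_def by metis
  \<comment> \<open>\<open>k h\<close> is a level from which \<open>B\<close> lies inside the answer
    to \<open>h\<close>. Finiteness of \<open>positions N\<close> bounds it by \<open>g N\<close>,
    the growth function that \<open>C\<close> is made to obey.\<close>
  have "\<exists>b. \<forall>h\<in>positions N. k h \<le> b" for N
    using finite_nat_set_iff_bounded_le[of "k ` positions N"] finite_positions by auto
  then obtain g where g: "\<And>N h. h \<in> positions N \<Longrightarrow> k h \<le> g N"
    by metis
  obtain C where C: "C \<in> filter_sets levels D" "slow g C"
    using slow by blast
  then obtain i where i: "strict_mono i" "\<And>n. g (i n) \<le> i (Suc n)" "C \<subseteq> (\<Union>n. level (i n))"
    "\<And>n. card (C \<inter> level (i n)) \<le> n"
    unfolding slow_def by blast
  \<comment> \<open>The moves of Player II are fixed in advance, independently of the play; it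
    remains to see that they are legal against \<open>\<sigma>\<close>.\<close>
  define a where "a n = B \<inter> C \<inter> level (i n)" for n
  have fin: "finite (level j)" for j
    by (simp add: level_def)
  have a: "finite (a n)" "card (a n) \<le> n" for n
  proof -
    show "finite (a n)"
      using fin by (simp add: a_def)
    have "card (a n) \<le> card (C \<inter> level (i n))"
      using fin by (intro card_mono) (auto simp: a_def)
    then show "card (a n) \<le> n"
      using i(4)[of n] by simp
  qed
  have "a n \<subseteq> I_move \<sigma> i a n" for n
  proof (cases n)
    case 0
    \<comment> \<open>The quota of move \<open>0\<close> is zero, so \<open>a 0\<close> is
      empty.\<close>
    then show ?thesis
      using a[of n] by simp
  next
    case (Suc m)
    let ?h = "map (\<lambda>m. (i m, a m)) [0..<n]"
    have "i j \<le> i m" if "j < n" for j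
      using that strict_mono_less_eq[OF i(1)] Suc by simp
    moreover have "n \<le> Suc (i m)"
      using strict_mono_imp_increasing[OF i(1), of m] Suc by simp
    ultimately have h: "?h \<in> positions (i m)"
      by (fastforce simp: positions_def a_def)
    \<comment> \<open>The chain is \<open>k ?h \<le> g (i m) \<le> i (Suc m)\<close>, so the new
      level lies beyond all exceptions for this position.\<close>
    then have "k ?h \<le> i n"
      using g i(2)[of m] Suc order_trans by blast
    then have "p \<in> \<sigma> ?h" if "p \<in> a n" for p
      using k[of ?h p] h that fst_level[of p "i n"] by (auto simp: a_def)
    then show ?thesis
      by (auto simp: I_move_def)
  qed
  then have "a n \<in> nsets_le (I_move \<sigma> i a n \<inter> level (i n)) n" for n
    using a[of n] by (auto simp: nsets_le_def nsets_def a_def)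
  then have "(\<Union>n. a n) \<notin> filter_sets levels D"
    by (rule win)
  moreover have "(\<Union>n. a n) = B \<inter> C"
    using i(3) by (auto simp: a_def)
  moreover have "B \<inter> C \<in> filter_sets levels D"
    using B(1) C(1) by (auto simp: filter_sets_def eventually_conj_iff)
  ultimately show False
    by simp
qed

theorem theorem6p2p7:
  assumes "CH"
  shows "\<exists>D. ultrafilter_on levels D \<and> semi_Ramsey D \<and> \<not> almost_Ramsey D"
proof -
  obtain R :: "(nat \<Rightarrow> bool) rel" where R: "wf R"
    "\<And>x y. x = y \<or> (x, y) \<in> R \<or> (y, x) \<in> R" "\<And>x. countable {y. (y, x) \<in> R}"
    using CH_well_order[OF assms] by blast
  obtain T :: "(nat \<Rightarrow> bool) \<Rightarrow> (nat \<times> nat) set"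
    where T: "\<And>x. pos (T x)" "\<And>x. T x \<subseteq> levels" "\<And>x y. (y, x) \<in> R \<Longrightarrow> T x \<subseteq>* T y"
      "\<And>x. slow (coded_fun x) (T x)" "\<And>x. T x \<subseteq> coded_set x \<or> T x \<inter> coded_set x = {}"
    using tower_exists[OF R] by blast
  have chain: "T x \<subseteq>* T y \<or> T y \<subseteq>* T x" for x y
    using R(2)[of x y] T(3) subset_almost_subset[of "T x" "T x"] by blast
  note sets = filter_sets_tower_filter[OF chain]
  have T_sets: "T x \<in> filter_sets levels (tower_filter T)" for x
    unfolding sets using T(2) subset_almost_subset by blast
  have "\<exists>x. T x \<subseteq> A \<or> T x \<inter> A = {}" for A
    using T(5) coded_set_surj[of A] by blast
  then have "ultrafilter_on levels (tower_filter T)"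
    using ultrafilter_tower_filter[of T] chain T(1,2) by blast
  moreover have "semi_Ramsey (tower_filter T)"
  proof (rule semi_RamseyI)
    fix A :: "nat \<Rightarrow> (nat \<times> nat) set"
    assume "\<And>n. A n \<in> filter_sets levels (tower_filter T)"
    then obtain x where x: "\<And>n. T (x n) \<subseteq>* A n"
      unfolding sets by metis
    \<comment> \<open>Strictly above the countably many witnesses there is a further index, and its
      tower set is almost below all of theirs.\<close>
    obtain z where "\<And>y. y \<in> range x \<Longrightarrow> (y, z) \<in> R"
      using countable_strict_upper_bound[OF R(2,3), of "range x"] by auto
    then have "T z \<subseteq>* A n" for n
      using T(3) x almost_subset_trans by blast
    then show "\<exists>C \<in> filter_sets levels (tower_filter T). \<forall>n. C \<subseteq>* A n"
      using T_sets by blast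
  next
    fix h
    obtain x where "coded_fun x = h"
      using coded_fun_surj by blast
    then show "\<exists>C \<in> filter_sets levels (tower_filter T). slow h C"
      using T_sets T(4)[of x] by blast
  qed
  moreover have "\<not> almost_Ramsey (tower_filter T)"
  proof (rule not_almost_Ramsey)
    fix A assume "A \<in> filter_sets levels (tower_filter T)"
    then obtain x where "T x \<subseteq>* A"
      unfolding sets by blast
    with T(1) show "pos A"
      by (rule pos_almost_subset)
  qed
  ultimately show ?thesis
    by blast
qed

end
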